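(* Let $\mathcal{P}$ be a homogeneous Poisson process of intensity $1$ on $\mathbb{R}$ and let $\mu$ be any probability measure on the strictly positive integers (the degree distribution). Then almost surely the graph given by the stable multi-matching has at most one infinite component, and almost surely the graph given by the random direction stable multi-matching has at most one infinite component.
   Context: Setting. Write $[\mathcal{P}]=\{x\in\mathbb{R}:\mathcal{P}(\{x\})>0\}$ for the point-set of $\mathcal{P}$. Conditionally on $\mathcal{P}$, the points $x\in[\mathcal{P}]$ carry i.i.d. marks $D_x$ with law $\mu$ ($D_x$ is the number of stubs, i.e. half-edges, at $x$); the resulting marked point process is denoted $(\mathcal{P},\xi)$ with $\xi(\{x\})=D_x$. Matching scheme. A matching scheme for $(\mathcal{P},\xi)$ is a point process $\mathcal{M}$ on the space of unordered pairs of points of $\mathbb{R}$ such that almost surely every pair $(x,y)\in[\mathcal{M}]$ has $x,y\in[\mathcal{P}]$, and in the graph $G$ with vertex set $[\mathcal{P}]$ and edge set $[\mathcal{M}]$ each vertex $x$ has degree exactly $D_x$. All matching schemes are assumed simple (almost surely $G$ has no self-loops and no multiple edges) and translation-invariant ($\mathcal{M}$ is invariant in law under all translations of $\mathbb{R}$). "Component" means connected component of $G$; it is infinite if it has infinitely many vertices. The length of an edge $(x,y)$ is $|x-y|$. Stable multi-matching. A matching scheme is a stable multi-matching if a.s., for any two distinct $x,y\in[\mathcal{P}]$, either they are linked by an edge or at least one of them has no incident edge longer than $|x-y|$. It is known that for a Poisson process an a.s. unique stable multi-matching exists. Random direction stable multi-matching. Conditionally on $(\mathcal{P},\xi)$,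 give each $x\in[\mathcal{P}]$ independently an integer mark $R_x\sim\mathrm{Binomial}(D_x,1/2)$. If $x<y$ and $(x,y)$ is an edge, it is called a right-edge of $x$ and a left-edge of $y$. A matching scheme is a random direction stable multi-matching if each $x\in[\mathcal{P}]$ has exactly $R_x$ incident right-edges and a.s., for any $x<y$ in $[\mathcal{P}]$, either $x,y$ are linked by an edge, or $x$ has no incident right-edge longer than $|x-y|$, or $y$ has no incident left-edge longer than $|x-y|$. Such a matching exists and is a.s. unique given the marked process. *)

theory Defs
  imports "HOL-Probability.Probability" "HOL-Library.Uprod"
begin

section \<open>Point processes\<close>

text \<open>
  All point processes here are simple, so a realisation is identified with its point-set.
  The parameter \<open>\<B>\<close> is the family of bounded Borel sets of the ground space; a configuration
  is a set with finitely many points in every member of \<open>\<B>\<close>, and the configuration space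
  carries the sigma-algebra generated by the counting maps \<open>S \<mapsto> card (S \<inter> B)\<close>.
\<close>

definition locally_finite :: "'b set set \<Rightarrow> 'b set set" where
  "locally_finite \<B> = {S. \<forall>B\<in>\<B>. finite (S \<inter> B)}"

definition configs :: "'b set set \<Rightarrow> 'b set measure" where
  "configs \<B> = sigma (locally_finite \<B>)
     {{S \<in> locally_finite \<B>. card (S \<inter> B) = n} | B n. B \<in> \<B>}"

definition point_process :: "'a measure \<Rightarrow> 'b set set \<Rightarrow> ('a \<Rightarrow> 'b set) \<Rightarrow> bool" where
  "point_process M \<B> N \<longleftrightarrow> N \<in> M \<rightarrow>\<^sub>M configs \<B>"

definition bounded_borel :: "real set set" where
  "bounded_borel = {B \<in> sets borel. bounded B}"

text \<open>A set of marked points is bounded if its projection to the line is.\<close>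

definition bounded_borel_marked :: "(real \<times> nat) set set" where
  "bounded_borel_marked =
     {B \<in> sets (borel \<Otimes>\<^sub>M count_space UNIV). bounded (fst ` B)}"

text \<open>The space of unordered pairs has the quotient structure of the plane.\<close>

definition bounded_borel_pairs :: "real uprod set set" where
  "bounded_borel_pairs =
     {A. {(x, y). Upair x y \<in> A} \<in> sets borel \<and> bounded {(x, y). Upair x y \<in> A}}"

definition poisson_process :: "'a measure \<Rightarrow> real \<Rightarrow> ('a \<Rightarrow> real set) \<Rightarrow> bool" where
  "poisson_process M \<rho> P \<longleftrightarrow>
     point_process M bounded_borel P \<and>
     (\<forall>B\<in>bounded_borel. \<forall>k.
        measure M {\<omega> \<in> space M. card (P \<omega> \<inter> B) = k} =
          (\<rho> * measure lborel B) ^ k / fact k * exp (- (\<rho> * measure lborel B))) \<and>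
     (\<forall>(n::nat) B. B ` {..<n} \<subseteq> bounded_borel \<longrightarrow> disjoint_family_on B {..<n} \<longrightarrow>
        prob_space.indep_vars M (\<lambda>_. count_space UNIV) (\<lambda>i \<omega>. card (P \<omega> \<inter> B i)) {..<n})"

section \<open>Conditionally independent marks\<close>

definition marked :: "('a \<Rightarrow> real set) \<Rightarrow> ('a \<Rightarrow> real \<Rightarrow> nat) \<Rightarrow> 'a \<Rightarrow> (real \<times> nat) set" where
  "marked P m \<omega> = (\<lambda>x. (x, m \<omega> x)) ` P \<omega>"

text \<open>
  Conditionally on the sigma-algebra \<open>F\<close>, with respect to which \<open>P\<close> is measurable, the marks
  \<open>m \<omega> x\<close> of the points \<open>x \<in> P \<omega>\<close> are independent with laws \<open>K \<omega> x\<close>. Since the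
  points are not labelled, this is expressed through arbitrary \<open>F\<close>-measurable choices
  \<open>X 0, \<dots>, X (n - 1)\<close> of finitely many distinct points. The values of \<open>m \<omega>\<close> outside
  \<open>P \<omega>\<close> play no role.
\<close>

definition conditionally_independent_marks ::
  "'a measure \<Rightarrow> 'a measure \<Rightarrow> ('a \<Rightarrow> real set) \<Rightarrow> ('a \<Rightarrow> real \<Rightarrow> nat pmf) \<Rightarrow>
   ('a \<Rightarrow> real \<Rightarrow> nat) \<Rightarrow> bool" where
  "conditionally_independent_marks M F P K m \<longleftrightarrow>
     point_process M bounded_borel_marked (marked P m) \<and>
     (\<forall>(n::nat) (X :: nat \<Rightarrow> 'a \<Rightarrow> real) (k :: nat \<Rightarrow> nat).
        (\<forall>i<n. X i \<in> borel_measurable F) \<longrightarrow>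
        (AE \<omega> in M. (\<forall>i<n. X i \<omega> \<in> P \<omega>) \<and> inj_on (\<lambda>i. X i \<omega>) {..<n}) \<longrightarrow>
        (AE \<omega> in M.
           real_cond_exp M F
             (indicator {\<omega> \<in> space M. \<forall>i<n. X i \<omega> \<in> P \<omega> \<and> m \<omega> (X i \<omega>) = k i}) \<omega>
           = (\<Prod>i<n. pmf (K \<omega> (X i \<omega>)) (k i))))"

definition iid_marks ::
  "'a measure \<Rightarrow> ('a \<Rightarrow> real set) \<Rightarrow> nat pmf \<Rightarrow> ('a \<Rightarrow> real \<Rightarrow> nat) \<Rightarrow> bool" where
  "iid_marks M P \<mu> D \<longleftrightarrow>
     conditionally_independent_marks M
       (vimage_algebra (space M) P (configs bounded_borel)) P (\<lambda>_ _. \<mu>) D"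

definition binomial_half_marks ::
  "'a measure \<Rightarrow> ('a \<Rightarrow> real set) \<Rightarrow> ('a \<Rightarrow> real \<Rightarrow> nat) \<Rightarrow> ('a \<Rightarrow> real \<Rightarrow> nat) \<Rightarrow> bool" where
  "binomial_half_marks M P D R \<longleftrightarrow>
     conditionally_independent_marks M
       (vimage_algebra (space M) (marked P D) (configs bounded_borel_marked)) P
       (\<lambda>\<omega> x. binomial_pmf (D \<omega> x) (1 / 2)) R"

section \<open>Matching schemes\<close>

text \<open>
  An edge set is a set of unordered pairs, so there are no multiple edges; self-loops are excluded
  by \<open>proper_uprod\<close>. Invariance under translations is invariance of the law of \<open>E\<close> on the
  configuration space of unordered pairs.
\<close>

definition matching_scheme ::
  "'a measure \<Rightarrow> ('a \<Rightarrow> real set) \<Rightarrow> ('a \<Rightarrow> real \<Rightarrow> nat) \<Rightarrow> ('a \<Rightarrow> real uprod set) \<Rightarrow> bool" where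
  "matching_scheme M P D E \<longleftrightarrow>
     point_process M bounded_borel_pairs E \<and>
     (AE \<omega> in M. \<forall>e\<in>E \<omega>. set_uprod e \<subseteq> P \<omega> \<and> proper_uprod e) \<and>
     (AE \<omega> in M. \<forall>x\<in>P \<omega>. finite {e \<in> E \<omega>. x \<in> set_uprod e} \<and>
                          card {e \<in> E \<omega>. x \<in> set_uprod e} = D \<omega> x) \<and>
     (\<forall>t::real. distr M (configs bounded_borel_pairs) (\<lambda>\<omega>. map_uprod (\<lambda>x. x + t) ` E \<omega>) =
                distr M (configs bounded_borel_pairs) E)"

definition stable_multi_matching ::
  "'a measure \<Rightarrow> ('a \<Rightarrow> real set) \<Rightarrow> ('a \<Rightarrow> real \<Rightarrow> nat) \<Rightarrow> ('a \<Rightarrow> real uprod set) \<Rightarrow> bool" where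
  "stable_multi_matching M P D E \<longleftrightarrow>
     matching_scheme M P D E \<and>
     (AE \<omega> in M. \<forall>x\<in>P \<omega>. \<forall>y\<in>P \<omega>. x \<noteq> y \<longrightarrow>
        Upair x y \<in> E \<omega> \<or>
        \<not> (\<exists>z. Upair x z \<in> E \<omega> \<and> \<bar>x - z\<bar> > \<bar>x - y\<bar>) \<or>
        \<not> (\<exists>z. Upair y z \<in> E \<omega> \<and> \<bar>y - z\<bar> > \<bar>x - y\<bar>))"

definition random_direction_stable_multi_matching ::
  "'a measure \<Rightarrow> ('a \<Rightarrow> real set) \<Rightarrow> ('a \<Rightarrow> real \<Rightarrow> nat) \<Rightarrow> ('a \<Rightarrow> real \<Rightarrow> nat) \<Rightarrow>
   ('a \<Rightarrow> real uprod set) \<Rightarrow> bool" where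
  "random_direction_stable_multi_matching M P D R E \<longleftrightarrow>
     matching_scheme M P D E \<and>
     (AE \<omega> in M. \<forall>x\<in>P \<omega>. finite {y. x < y \<and> Upair x y \<in> E \<omega>} \<and>
                          card {y. x < y \<and> Upair x y \<in> E \<omega>} = R \<omega> x) \<and>
     (AE \<omega> in M. \<forall>x\<in>P \<omega>. \<forall>y\<in>P \<omega>. x < y \<longrightarrow>
        Upair x y \<in> E \<omega> \<or>
        \<not> (\<exists>z>x. Upair x z \<in> E \<omega> \<and> \<bar>x - z\<bar> > \<bar>x - y\<bar>) \<or>
        \<not> (\<exists>z<y. Upair z y \<in> E \<omega> \<and> \<bar>z - y\<bar> > \<bar>x - y\<bar>))"

section \<open>Components\<close>

definition components :: "'v set \<Rightarrow> 'v uprod set \<Rightarrow> 'v set set" where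
  "components V E =
     {{y \<in> V. (x, y) \<in> {(u, v). u \<in> V \<and> v \<in> V \<and> Upair u v \<in> E}\<^sup>*} | x. x \<in> V}"

definition at_most_one_infinite_component :: "'v set \<Rightarrow> 'v uprod set \<Rightarrow> bool" where
  "at_most_one_infinite_component V E \<longleftrightarrow>
     (\<forall>C\<in>components V E. \<forall>C'\<in>components V E. infinite C \<longrightarrow> infinite C' \<longrightarrow> C = C')"

end

theory Submission
  imports Defs
begin

text \<open>
  Stability is used only through crossing edges. If \<open>x < u < y < v\<close> and both \<open>x y\<close> and \<open>u v\<close> are
  edges, then each of \<open>u\<close> and \<open>y\<close> has an edge, pointing towards the other, that is longer than
  \<open>\<bar>u - y\<bar>\<close>, so both notions of stability force \<open>u y\<close> to be an edge. Edges of different components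
  therefore never cross. An infinite component that has a vertex strictly below an edge must leave
  the finite set of vertices below that edge, hence contains the edge
  (\<open>edge_over_infinite_component\<close>).

  Suppose that there are two infinite components. The edges of a connected graph on the line cover
  everything between any two of its vertices, so by the previous remark neither component has a
  vertex between two vertices of the other, and one of them, \<open>C\<close>, lies entirely to the left of the
  other. Since the vertices do not accumulate, \<open>C\<close> has a rightmost vertex \<open>m\<close> and is unbounded to the
  left, so that every \<open>z \<le> m\<close> is covered
  by an interval \<open>{x<..y}\<close> with \<open>x y\<close> an edge, whereas no edge covers the points directly to the
  right of \<open>m\<close> (\<open>two_infinite_components_gap\<close>). Thus the infimum of the uncovered points is finite.
  This infimum moves along with translations of the edge set, and no finite random variable has a
  translation-invariant law. The last step takes the following elementary form: the events
  ``everything to the left of \<open>r\<close> is covered'' decrease in \<open>r\<close> and all have the same probability, so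
  almost surely either all of them (for rational \<open>r\<close>) occur or none does (\<open>covered_left_AE\<close>).
\<close>

section \<open>Graphs on the line in which crossing edges are joined\<close>

locale crossing_joined_graph =
  fixes V :: "real set" and E :: "real uprod set"
  assumes edge_in_V: "Upair x y \<in> E \<Longrightarrow> x \<in> V \<and> y \<in> V"
    and finite_V_Icc: "finite (V \<inter> {a..b})"
    and crossing: "\<lbrakk>Upair x y \<in> E; Upair u v \<in> E; x < u; u < y; y < v\<rbrakk> \<Longrightarrow> Upair u y \<in> E"
begin

lemma Upair_edge_sym: "Upair x y \<in> E \<Longrightarrow> Upair y x \<in> E"
  by (subst Upair_inject[THEN iffD2, of y x x y]) auto

lemma component_subset: "C \<in> components V E \<Longrightarrow> C \<subseteq> V"
  by (auto simp: components_def)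

lemma component_edge:
  assumes "C \<in> components V E" "x \<in> C" "Upair x y \<in> E"
  shows "y \<in> C"
proof -
  obtain z where C: "C = {y \<in> V. (z, y) \<in> {(u, v). u \<in> V \<and> v \<in> V \<and> Upair u v \<in> E}\<^sup>*}"
    (is "_ = {y \<in> V. (z, y) \<in> ?R\<^sup>*}")
    using assms(1) unfolding components_def by blast
  have "(z, x) \<in> ?R\<^sup>*" "(x, y) \<in> ?R" "y \<in> V"
    using assms(2,3) edge_in_V[OF assms(3)] unfolding C by simp_all
  then show ?thesis
    unfolding C by (blast intro: rtrancl_into_rtrancl)
qed

lemma component_connected:
  assumes "C \<in> components V E" "x \<in> C" "y \<in> C"
  shows "(x, y) \<in> {(u, v). u \<in> V \<and> v \<in> V \<and> Upair u v \<in> E}\<^sup>*" (is "_ \<in> ?R\<^sup>*")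
proof -
  have "sym (?R\<^sup>*)"
    by (intro sym_rtrancl symI) (auto intro: Upair_edge_sym)
  moreover obtain z where "(z, x) \<in> ?R\<^sup>*" "(z, y) \<in> ?R\<^sup>*"
    using assms unfolding components_def by blast
  ultimately show ?thesis
    by (blast intro: rtrancl_trans dest: symD)
qed

lemma components_disjoint:
  assumes "C \<in> components V E" "C' \<in> components V E" "x \<in> C" "x \<in> C'"
  shows "C = C'"
proof -
  have "A = {y \<in> V. (x, y) \<in> {(u, v). u \<in> V \<and> v \<in> V \<and> Upair u v \<in> E}\<^sup>*}" (is "_ = ?K")
    if A: "A \<in> components V E" "x \<in> A" for A
  proof
    show "A \<subseteq> ?K"
      using component_connected[OF A] component_subset[OF A(1)] by auto
    show "?K \<subseteq> A"
    proof
      fix y assume "y \<in> ?K"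
      then show "y \<in> A"
        using A unfolding components_def by (blast intro: rtrancl_trans)
    qed
  qed
  from this[OF assms(1,3)] this[OF assms(2,4)] show ?thesis
    by (rule trans[OF _ sym])
qed

lemma component_exit:
  assumes C: "C \<in> components V E" and w: "w \<in> C" "w \<in> S" and z: "z \<in> C" "z \<notin> S"
  shows "\<exists>u v. u \<in> C \<and> u \<in> S \<and> v \<in> C \<and> v \<notin> S \<and> Upair u v \<in> E"
proof -
  have "(w, z) \<in> {(u, v). u \<in> V \<and> v \<in> V \<and> Upair u v \<in> E}\<^sup>*"
    using component_connected[OF C w(1) z(1)] .
  then have "z \<in> C \<and> (z \<in> S \<or> (\<exists>u v. u \<in> C \<and> u \<in> S \<and> v \<in> C \<and> v \<notin> S \<and> Upair u v \<in> E))"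
  proof induction
    case base
    then show ?case using w by simp
  next
    case (step a b)
    then show ?case using component_edge[OF C, of a b] by blast
  qed
  then show ?thesis
    using z by blast
qed

lemma component_covers_between:
  assumes "C \<in> components V E" "a \<in> C" "b \<in> C" "a < z" "z \<le> b"
  obtains x y where "x \<in> C" "y \<in> C" "Upair x y \<in> E" "x < z" "z \<le> y"
proof -
  have "\<exists>u v. u \<in> C \<and> u \<in> {..<z} \<and> v \<in> C \<and> v \<notin> {..<z} \<and> Upair u v \<in> E"
    by (rule component_exit[OF assms(1,2) _ assms(3)]) (use assms(4,5) in simp_all)
  then show ?thesis
    using that by (metis lessThan_iff not_less)
qed

text \<open>
  An infinite component with a vertex strictly below an edge has to leave the finitely many vertices
  there. The edge by which it leaves either shares an endpoint with the given edge or crosses it.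
\<close>

lemma edge_over_infinite_component:
  assumes C: "C \<in> components V E" "infinite C" and w: "w \<in> C" "x < w" "w < y"
    and e: "Upair x y \<in> E"
  shows "x \<in> C"
proof -
  have "\<not> C \<subseteq> {x<..<y}"
  proof
    assume "C \<subseteq> {x<..<y}"
    then have "C \<subseteq> V \<inter> {x..y}"
      using component_subset[OF C(1)] by fastforce
    then show False
      using C(2) finite_V_Icc finite_subset by blast
  qed
  then obtain z where "z \<in> C" "z \<notin> {x<..<y}" by blast
  then obtain u v where uv: "u \<in> C" "x < u" "u < y" "v \<in> C" "v \<notin> {x<..<y}" "Upair u v \<in> E"
    using component_exit[OF C(1) w(1) _ \<open>z \<in> C\<close>, of "{x<..<y}"] w by force
  have y: "x \<in> C" if "y \<in> C"
    using component_edge[OF C(1) that] Upair_edge_sym[OF e] by blast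
  consider "v = x" | "v = y" | "v < x" | "y < v"
    using uv(5) by fastforce
  then show ?thesis
  proof cases
    case 3
    then have "Upair x u \<in> E"
      using crossing[of v u x y] uv e Upair_edge_sym by blast
    then show ?thesis
      using component_edge[OF C(1) uv(1)] Upair_edge_sym by blast
  next
    case 4
    then have "Upair u y \<in> E"
      using crossing[of x y u v] uv e by blast
    then show ?thesis
      using component_edge[OF C(1) uv(1)] y by blast
  qed (use uv y in auto)
qed

lemma infinite_components_not_interleaved:
  assumes C: "C \<in> components V E" and C': "C' \<in> components V E" "infinite C'"
    and ab: "a \<in> C" "b \<in> C" and w: "w \<in> C'" "a \<le> w" "w \<le> b"
  shows "C = C'"
proof (cases "w \<in> C")
  case True
  then show ?thesis using components_disjoint C C' w by blast
next
  case False
  then have "a < w" using ab w by (metis order_le_less)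
  then obtain x y where xy: "x \<in> C" "y \<in> C" "Upair x y \<in> E" "x < w" "w \<le> y"
    using component_covers_between[OF C ab] w by blast
  with False have "w < y" by (metis order_le_less)
  then have "x \<in> C'"
    using edge_over_infinite_component[OF C' w(1)] xy by blast
  then show ?thesis
    using components_disjoint C C' xy by blast
qed

end

section \<open>Covering an initial half-line by edges\<close>

text \<open>
  Only rational points are tested, which makes this property measurable. The intervals \<open>{x<..y}\<close> are
  half-open so that a component which is cut by one of its vertices still covers that vertex.
\<close>

definition covered :: "real uprod set \<Rightarrow> real \<Rightarrow> bool" where
  "covered E z \<longleftrightarrow> (\<exists>x y. x < z \<and> z \<le> y \<and> Upair x y \<in> E)"

definition covered_left :: "real uprod set \<Rightarrow> real \<Rightarrow> bool" where
  "covered_left E r \<longleftrightarrow> (\<forall>q\<in>\<rat>. q \<le> r \<longrightarrow> covered E q)"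

text \<open>
  A component that is bounded on the right is infinite only if it extends to \<open>-\<infinity>\<close>, so its edges
  cover everything up to its last vertex \<open>m\<close>. An edge over a point directly to the right of \<open>m\<close> would
  start at \<open>m\<close> or pass over \<open>m\<close>, hence belong to the component and end at a vertex beyond \<open>m\<close>.
\<close>

lemma (in crossing_joined_graph) left_component_gap:
  assumes C: "C \<in> components V E" "infinite C" and c': "c' \<in> V" "\<And>c. c \<in> C \<Longrightarrow> c < c'"
  shows "\<exists>r\<in>\<rat>. \<exists>s\<in>\<rat>. r \<le> s \<and> covered_left E r \<and> \<not> covered_left E s"
proof -
  have fin: "finite (C \<inter> {z..})" for z
    by (rule finite_subset[OF _ finite_V_Icc[of z c']])
       (use c' component_subset[OF C(1)] in force)
  have unbounded: "\<exists>b\<in>C. b < z" for z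
  proof (rule ccontr)
    assume "\<not> (\<exists>b\<in>C. b < z)"
    then have "C = C \<inter> {z..}" by force
    then show False using fin[of z] C(2) by metis
  qed
  obtain c where c: "c \<in> C" using C(2) by fastforce
  define m where "m = Max (C \<inter> {c..})"
  have "m \<in> C \<inter> {c..}"
    unfolding m_def by (rule Max_in[OF fin]) (use c in auto)
  then have mC: "m \<in> C" and "c \<le> m" by auto
  have m_max: "b \<le> m" if "b \<in> C" for b
  proof (cases "c \<le> b")
    case True
    then show ?thesis unfolding m_def using that by (intro Max_ge[OF fin]) auto
  qed (use \<open>c \<le> m\<close> in auto)
  \<comment> \<open>The next vertex to the right of \<open>m\<close>, whatever its component, bounds the uncovered gap.\<close>
  have finV: "finite (V \<inter> {m<..c'})"
    by (rule finite_subset[OF _ finite_V_Icc[of m c']]) auto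
  define p where "p = Min (V \<inter> {m<..c'})"
  have "p \<in> V \<inter> {m<..c'}"
    unfolding p_def by (rule Min_in[OF finV]) (use c' mC in auto)
  then have "m < p" "p \<le> c'" by auto
  have p_min: "p \<le> v" if "v \<in> V" "m < v" for v
  proof (cases "v \<le> c'")
    case True
    then show ?thesis unfolding p_def using that by (intro Min_le[OF finV]) auto
  qed (use \<open>p \<le> c'\<close> in auto)
  obtain s where s: "s \<in> \<rat>" "m < s" "s < p"
    using Rats_dense_in_real[OF \<open>m < p\<close>] by blast
  obtain r where r: "r \<in> \<rat>" "r < m"
    using Rats_dense_in_real[of "m - 1" m] by auto
  have "covered_left E r"
    unfolding covered_left_def
  proof (intro ballI impI)
    fix q :: real assume "q \<le> r"
    obtain b where "b \<in> C" "b < q" using unbounded by blast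
    then show "covered E q"
      using component_covers_between[OF C(1) _ mC, of b q] r \<open>q \<le> r\<close>
      unfolding covered_def by (metis less_imp_le order_trans)
  qed
  moreover have "\<not> covered E s"
  proof
    assume "covered E s"
    then obtain x y where xy: "x < s" "s \<le> y" "Upair x y \<in> E"
      unfolding covered_def by blast
    have "x \<in> C"
    proof -
      have "x \<le> m"
        using p_min[of x] edge_in_V[OF xy(3)] xy s by force
      then show ?thesis
        using edge_over_infinite_component[OF C mC, of x y] xy s mC
        by (cases "x = m") auto
    qed
    then have "y \<le> m"
      using component_edge[OF C(1)] xy(3) m_max by blast
    with xy s show False by simp
  qed
  then have "\<not> covered_left E s"
    using s(1) unfolding covered_left_def by blast
  moreover have "r \<le> s" using r s by simp
  ultimately show ?thesis
    using r(1) s(1) by blast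
qed

lemma (in crossing_joined_graph) two_infinite_components_gap:
  assumes "\<not> at_most_one_infinite_component V E"
  shows "\<exists>r\<in>\<rat>. \<exists>s\<in>\<rat>. r \<le> s \<and> covered_left E r \<and> \<not> covered_left E s"
proof -
  obtain A B where AB: "A \<in> components V E" "B \<in> components V E" "infinite A" "infinite B" "A \<noteq> B"
    using assms unfolding at_most_one_infinite_component_def by blast
  obtain a b where ab: "a \<in> A" "b \<in> B"
    using AB by (metis finite.emptyI ex_in_conv)
  have *: "\<exists>r\<in>\<rat>. \<exists>s\<in>\<rat>. r \<le> s \<and> covered_left E r \<and> \<not> covered_left E s"
    if C: "C \<in> components V E" "C' \<in> components V E" "infinite C" "infinite C'" "C \<noteq> C'"
      and c: "c \<in> C" "c' \<in> C'" "c \<le> c'" for C C' c c'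
  proof (rule left_component_gap)
    show "d < c'" if "d \<in> C" for d
    proof (rule ccontr)
      assume "\<not> d < c'"
      then show False
        using infinite_components_not_interleaved[OF C(1,2,4) c(1) that c(2) c(3)] C(5) by simp
    qed
  qed (use C c component_subset in auto)
  show ?thesis
  proof (cases "a \<le> b")
    case True
    show ?thesis by (rule *[OF AB ab True])
  next
    case False
    then show ?thesis by (intro *[OF AB(2,1,4,3) AB(5)[symmetric] ab(2,1)]) simp
  qed
qed

section \<open>Translation invariance\<close>

lemma space_configs: "space (configs \<B>) = locally_finite \<B>"
  unfolding configs_def by (rule space_measure_of) auto

lemma sets_configs:
  "sets (configs \<B>) = sigma_sets (locally_finite \<B>)
     {{S \<in> locally_finite \<B>. card (S \<inter> B) = n} | B n. B \<in> \<B>}"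
  unfolding configs_def by (rule sets_measure_of) blast

lemma sets_configs_count:
  assumes "B \<in> \<B>"
  shows "{S \<in> locally_finite \<B>. card (S \<inter> B) = n} \<in> sets (configs \<B>)"
  unfolding configs_def using assms by (intro in_measure_of) blast+

lemma sets_configs_hit:
  assumes "B \<in> \<B>"
  shows "{S \<in> locally_finite \<B>. S \<inter> B \<noteq> {}} \<in> sets (configs \<B>)"
proof -
  have "{S \<in> locally_finite \<B>. S \<inter> B \<noteq> {}} =
      space (configs \<B>) - {S \<in> locally_finite \<B>. card (S \<inter> B) = 0}"
    using assms by (force simp: space_configs locally_finite_def card_eq_0_iff)
  then show ?thesis
    using sets_configs_count[OF assms, of 0] by simp
qed

lemma bounded_borel_pairs_translate:
  assumes "B \<in> bounded_borel_pairs"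
  shows "map_uprod (\<lambda>x. x + t) -` B \<in> bounded_borel_pairs"
proof -
  let ?A = "{(x, y). Upair x y \<in> B}"
  have A: "?A \<in> sets borel" "bounded ?A"
    using assms by (auto simp: bounded_borel_pairs_def)
  have eq: "{(x, y). Upair x y \<in> map_uprod (\<lambda>x. x + t) -` B} = (\<lambda>z. z + (t, t)) -` ?A"
    by auto
  have "(\<lambda>z. z + (t, t)) -` ?A = (\<lambda>z. z + (- t, - t)) ` ?A"
  proof
    show "(\<lambda>z. z + (t, t)) -` ?A \<subseteq> (\<lambda>z. z + (- t, - t)) ` ?A"
    proof
      fix z assume "z \<in> (\<lambda>z. z + (t, t)) -` ?A"
      moreover have "z = (z + (t, t)) + (- t, - t)"
        by (simp add: prod_eq_iff)
      ultimately show "z \<in> (\<lambda>z. z + (- t, - t)) ` ?A"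
        by (intro image_eqI[of z _ "z + (t, t)"]) (simp_all only: vimage_eq)
    qed
  qed auto
  also have "\<dots> = (+) (- t, - t) ` ?A"
    by (intro image_cong) auto
  finally have "bounded ((\<lambda>z. z + (t, t)) -` ?A)"
    using bounded_translation[OF A(2)] by simp
  moreover have "(\<lambda>z. z + (t, t)) -` ?A \<in> sets borel"
  proof -
    have "(\<lambda>z::real \<times> real. z + (t, t)) \<in> borel_measurable borel" by simp
    from measurable_sets[OF this A(1)] show ?thesis by simp
  qed
  ultimately show ?thesis
    unfolding bounded_borel_pairs_def mem_Collect_eq eq by blast
qed

lemma card_translate_Int:
  "card (map_uprod (\<lambda>x::real. x + t) ` S \<inter> B) = card (S \<inter> map_uprod (\<lambda>x. x + t) -` B)"
  "finite (map_uprod (\<lambda>x::real. x + t) ` S \<inter> B) = finite (S \<inter> map_uprod (\<lambda>x. x + t) -` B)"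
proof -
  have eq: "map_uprod (\<lambda>x. x + t) ` S \<inter> B =
      map_uprod (\<lambda>x. x + t) ` (S \<inter> map_uprod (\<lambda>x. x + t) -` B)"
    by auto
  have inj: "inj_on (map_uprod (\<lambda>x. x + t)) A" for A
    by (rule inj_on_subset[OF uprod.inj_map]) (auto simp: inj_def)
  show "card (map_uprod (\<lambda>x. x + t) ` S \<inter> B) = card (S \<inter> map_uprod (\<lambda>x. x + t) -` B)"
    unfolding eq by (rule card_image[OF inj])
  show "finite (map_uprod (\<lambda>x. x + t) ` S \<inter> B) = finite (S \<inter> map_uprod (\<lambda>x. x + t) -` B)"
    unfolding eq by (rule finite_image_iff[OF inj])
qed

lemma measurable_translate_configs:
  "(\<lambda>S. map_uprod (\<lambda>x. x + t) ` S) \<in> configs bounded_borel_pairs \<rightarrow>\<^sub>M configs bounded_borel_pairs"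
proof -
  have lf: "map_uprod (\<lambda>x. x + t) ` S \<in> locally_finite bounded_borel_pairs"
    if "S \<in> locally_finite bounded_borel_pairs" for S
    using that bounded_borel_pairs_translate
    by (auto simp: locally_finite_def card_translate_Int)
  show ?thesis
  proof (rule measurable_sigma_sets[OF sets_configs])
    fix A assume "A \<in> {{S \<in> locally_finite bounded_borel_pairs. card (S \<inter> B) = n} | B n.
      B \<in> bounded_borel_pairs}"
    then obtain B n where B: "B \<in> bounded_borel_pairs"
      and A: "A = {S \<in> locally_finite bounded_borel_pairs. card (S \<inter> B) = n}" by blast
    have "(\<lambda>S. map_uprod (\<lambda>x. x + t) ` S) -` A \<inter> locally_finite bounded_borel_pairs =
        {S \<in> locally_finite bounded_borel_pairs. card (S \<inter> map_uprod (\<lambda>x. x + t) -` B) = n}"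
      using lf by (auto simp: A card_translate_Int)
    then show "(\<lambda>S. map_uprod (\<lambda>x. x + t) ` S) -` A \<inter> space (configs bounded_borel_pairs)
        \<in> sets (configs bounded_borel_pairs)"
      using sets_configs_count[OF bounded_borel_pairs_translate[OF B], of t n]
      by (simp add: space_configs)
  qed (use lf in \<open>auto simp: space_configs\<close>)
qed

text \<open>
  The pairs that cover \<open>z\<close> form an unbounded set, which is exhausted by bounded ones.
\<close>

lemma sets_covered:
  "{S \<in> locally_finite bounded_borel_pairs. covered S z} \<in> sets (configs bounded_borel_pairs)"
proof -
  define B where
    "B n = {e. \<exists>x y. e = Upair x y \<and> x < z \<and> z \<le> y \<and> \<bar>x\<bar> \<le> real n \<and> \<bar>y\<bar> \<le> real n}" for n :: nat
  have B: "B n \<in> bounded_borel_pairs" for n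
  proof -
    define K where "K = {p. (fst p < z \<and> z \<le> snd p \<or> snd p < z \<and> z \<le> fst p)
        \<and> \<bar>fst p\<bar> \<le> real n \<and> \<bar>snd p\<bar> \<le> real n}"
    have eq: "{(x, y). Upair x y \<in> B n} = K"
      unfolding B_def K_def by (auto; blast)
    have "{p \<in> space (borel \<Otimes>\<^sub>M borel). (fst p < z \<and> z \<le> snd p \<or> snd p < z \<and> z \<le> fst p)
        \<and> \<bar>fst p\<bar> \<le> real n \<and> \<bar>snd p\<bar> \<le> real n} \<in> sets (borel \<Otimes>\<^sub>M borel)"
      by measurable
    then have "K \<in> sets borel"
      unfolding borel_prod by (simp add: K_def)
    moreover have "K \<subseteq> {- real n..real n} \<times> {- real n..real n}"
      by (auto simp: K_def abs_le_iff)
    then have "bounded K"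
      using bounded_subset[OF bounded_Times] bounded_closed_interval by blast
    ultimately show ?thesis
      unfolding bounded_borel_pairs_def mem_Collect_eq eq by blast
  qed
  have "covered S z \<longleftrightarrow> (\<exists>n. S \<inter> B n \<noteq> {})" for S
  proof
    assume "covered S z"
    then obtain x y where xy: "x < z" "z \<le> y" "Upair x y \<in> S"
      unfolding covered_def by blast
    obtain n where "max \<bar>x\<bar> \<bar>y\<bar> \<le> real n" using real_arch_simple by blast
    then have "Upair x y \<in> B n" using xy by (auto simp: B_def)
    then show "\<exists>n. S \<inter> B n \<noteq> {}" using xy by blast
  qed (auto simp: covered_def B_def)
  then have "{S \<in> locally_finite bounded_borel_pairs. covered S z} =
      (\<Union>n. {S \<in> locally_finite bounded_borel_pairs. S \<inter> B n \<noteq> {}})"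
    by auto
  then show ?thesis
    using sets_configs_hit[OF B] by auto
qed

lemma sets_covered_left:
  "{S \<in> locally_finite bounded_borel_pairs. covered_left S r} \<in> sets (configs bounded_borel_pairs)"
    (is "?G \<in> _")
proof -
  have "?G = {S \<in> space (configs bounded_borel_pairs). \<forall>q\<in>{q\<in>\<rat>. q \<le> r}. covered S q}"
    by (auto simp: space_configs covered_left_def)
  also have "\<dots> \<in> sets (configs bounded_borel_pairs)"
    by (intro sets.sets_Collect_countable_All')
       (auto simp: space_configs sets_covered intro: countable_subset[OF _ countable_rat])
  finally show ?thesis .
qed

lemma covered_translate: "covered (map_uprod (\<lambda>x. x + t) ` E) (z + t) \<longleftrightarrow> covered E z"
proof
  assume "covered E z"
  then obtain x y where "x < z" "z \<le> y" "Upair x y \<in> E"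
    unfolding covered_def by blast
  then show "covered (map_uprod (\<lambda>x. x + t) ` E) (z + t)"
    unfolding covered_def
    by (intro exI[of _ "x + t"] exI[of _ "y + t"]) (auto intro!: image_eqI[of _ _ "Upair x y"])
next
  assume "covered (map_uprod (\<lambda>x. x + t) ` E) (z + t)"
  then obtain x y e where xy: "x < z + t" "z + t \<le> y" "e \<in> E" "Upair x y = map_uprod (\<lambda>x. x + t) e"
    unfolding covered_def by blast
  obtain u v where e: "e = Upair u v" by (cases e) auto
  have "(u < z \<and> z \<le> v) \<or> (v < z \<and> z \<le> u)" using xy e by auto
  then show "covered E z"
    unfolding covered_def using xy(3) e by (metis Upair_inject)
qed

text \<open>Rationality of the shift keeps the set of tested points.\<close>

lemma covered_left_translate:
  assumes "t \<in> \<rat>"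
  shows "covered_left (map_uprod (\<lambda>x. x + t) ` E) (r + t) \<longleftrightarrow> covered_left E r"
proof
  assume L: "covered_left (map_uprod (\<lambda>x. x + t) ` E) (r + t)"
  show "covered_left E r"
    unfolding covered_left_def
  proof (intro ballI impI)
    fix q :: real assume "q \<in> \<rat>" "q \<le> r"
    then have "covered (map_uprod (\<lambda>x. x + t) ` E) (q + t)"
      using L assms unfolding covered_left_def by simp
    then show "covered E q" by (simp add: covered_translate)
  qed
next
  assume L: "covered_left E r"
  show "covered_left (map_uprod (\<lambda>x. x + t) ` E) (r + t)"
    unfolding covered_left_def
  proof (intro ballI impI)
    fix q :: real assume "q \<in> \<rat>" "q \<le> r + t"
    then have "covered E (q - t)"
      using L assms unfolding covered_left_def by simp
    then show "covered (map_uprod (\<lambda>x. x + t) ` E) q"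
      using covered_translate[of t E "q - t"] by simp
  qed
qed

text \<open>
  Shifting the edge set by \<open>s - r\<close> turns \<open>covered_left E r\<close> into \<open>covered_left E s\<close>, so the two
  events have equal probability. For \<open>r < s\<close> the second is contained in the first, and they differ
  by a null set.
\<close>

lemma covered_left_AE:
  assumes "prob_space M" and E: "point_process M bounded_borel_pairs E"
    and inv: "\<And>t::real. distr M (configs bounded_borel_pairs) (\<lambda>\<omega>. map_uprod (\<lambda>x. x + t) ` E \<omega>) =
                distr M (configs bounded_borel_pairs) E"
  shows "AE \<omega> in M. \<forall>r\<in>\<rat>. \<forall>s\<in>\<rat>. covered_left (E \<omega>) r \<longrightarrow> covered_left (E \<omega>) s"
proof -
  interpret prob_space M by fact
  let ?N = "configs bounded_borel_pairs"
  have E_meas: "E \<in> M \<rightarrow>\<^sub>M ?N"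
    using E by (simp add: point_process_def)
  have E_lf: "E \<omega> \<in> locally_finite bounded_borel_pairs" if "\<omega> \<in> space M" for \<omega>
    using measurable_space[OF E_meas that] by (simp add: space_configs)
  define G where "G r = {S \<in> locally_finite bounded_borel_pairs. covered_left S r}" for r
  have G: "G r \<in> sets ?N" for r
    unfolding G_def by (rule sets_covered_left)
  have same: "measure (distr M ?N E) (G (r + t)) = measure (distr M ?N E) (G r)" if "t \<in> \<rat>" for r t
  proof -
    let ?T = "\<lambda>S. map_uprod (\<lambda>x. x + t) ` S"
    have T: "?T \<in> ?N \<rightarrow>\<^sub>M ?N" by (rule measurable_translate_configs)
    have "measure (distr M ?N E) (G (r + t)) = measure (distr M ?N (\<lambda>\<omega>. ?T (E \<omega>))) (G (r + t))"
      by (simp add: inv)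
    also have "\<dots> = measure M ((\<lambda>\<omega>. ?T (E \<omega>)) -` G (r + t) \<inter> space M)"
      by (intro measure_distr measurable_compose[OF E_meas T] G)
    also have "(\<lambda>\<omega>. ?T (E \<omega>)) -` G (r + t) \<inter> space M = E -` G r \<inter> space M"
      using measurable_space[OF T] E_lf
      by (auto simp: G_def covered_left_translate[OF that] space_configs)
    also have "measure M \<dots> = measure (distr M ?N E) (G r)"
      by (intro measure_distr[symmetric] E_meas G)
    finally show ?thesis .
  qed
  have "AE \<omega> in M. covered_left (E \<omega>) r \<longrightarrow> covered_left (E \<omega>) s" if "r \<in> \<rat>" "s \<in> \<rat>" for r s
  proof (cases "s \<le> r")
    case True
    then show ?thesis unfolding covered_left_def by auto
  next
    case False
    let ?A = "\<lambda>r. E -` G r \<inter> space M"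
    have sets_A: "?A r \<in> sets M" for r by (rule measurable_sets[OF E_meas G])
    have sub: "?A s \<subseteq> ?A r" using False by (auto simp: G_def covered_left_def)
    have "measure M (?A s) = measure M (?A r)"
      using same[of "s - r" r] that by (simp add: measure_distr[OF E_meas G])
    then have "measure M (?A r - ?A s) = 0"
      using finite_measure_Diff[OF sets_A sets_A sub] by simp
    then have "?A r - ?A s \<in> null_sets M"
      using sets_A by (simp add: null_sets_def emeasure_eq_measure)
    then have "AE \<omega> in M. \<omega> \<notin> ?A r - ?A s" by (rule AE_not_in)
    then show ?thesis
      using E_lf by (auto simp: G_def elim!: AE_mp)
  qed
  then show ?thesis
    by (intro AE_ball_countable' countable_rat)
qed

section \<open>Matching schemes whose crossing edges are joined\<close>

lemma finite_Icc_of_point_process: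
  assumes "point_process M bounded_borel P" "\<omega> \<in> space M"
  shows "finite (P \<omega> \<inter> {a..b})"
proof -
  have "P \<omega> \<in> locally_finite bounded_borel"
    using measurable_space[OF assms(1)[unfolded point_process_def] assms(2)]
    unfolding space_configs .
  moreover have "{a..b} \<in> bounded_borel"
    unfolding bounded_borel_def using bounded_closed_interval[of a b] by simp
  ultimately show ?thesis
    unfolding locally_finite_def by blast
qed

text \<open>
  The hypothesis \<open>crossing\<close> is what the two notions of stability have in common. The gap produced by
  two infinite components would be a place where covering stops, which stationarity excludes.
\<close>

lemma matching_scheme_unique_infinite_component:
  assumes M: "prob_space M" and P: "point_process M bounded_borel P"
    and E: "matching_scheme M P D E"
    and crossing: "AE \<omega> in M. \<forall>x\<in>P \<omega>. \<forall>y\<in>P \<omega>. \<forall>u\<in>P \<omega>. \<forall>v\<in>P \<omega>.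
        Upair x y \<in> E \<omega> \<longrightarrow> Upair u v \<in> E \<omega> \<longrightarrow> x < u \<longrightarrow> u < y \<longrightarrow> y < v \<longrightarrow> Upair u y \<in> E \<omega>"
  shows "AE \<omega> in M. at_most_one_infinite_component (P \<omega>) (E \<omega>)"
proof -
  have 1: "AE \<omega> in M. \<forall>e\<in>E \<omega>. set_uprod e \<subseteq> P \<omega> \<and> proper_uprod e"
    and 2: "AE \<omega> in M. \<forall>r\<in>\<rat>. \<forall>s\<in>\<rat>. covered_left (E \<omega>) r \<longrightarrow> covered_left (E \<omega>) s"
    using E covered_left_AE[OF M, of E] by (auto simp: matching_scheme_def)
  show ?thesis
    using 1 2 crossing AE_space
  proof eventually_elim
    case (elim \<omega>)
    have inP: "x \<in> P \<omega> \<and> y \<in> P \<omega>" if "Upair x y \<in> E \<omega>" for x y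
      using elim(1) that by fastforce
    interpret crossing_joined_graph "P \<omega>" "E \<omega>"
      by standard (use inP finite_Icc_of_point_process[OF P elim(4)] elim(3) in blast)+
    show ?case
      using two_infinite_components_gap elim(2) by blast
  qed
qed

theorem proposition1p1:
  fixes M :: "'a measure"
    and P :: "'a \<Rightarrow> real set"
    and \<mu> :: "nat pmf"
    and D :: "'a \<Rightarrow> real \<Rightarrow> nat"
  assumes "prob_space M"
    and "poisson_process M 1 P"
    and "0 \<notin> set_pmf \<mu>"
    and "iid_marks M P \<mu> D"
  shows "(\<forall>E. stable_multi_matching M P D E \<longrightarrow>
            (AE \<omega> in M. at_most_one_infinite_component (P \<omega>) (E \<omega>))) \<and>
         (\<forall>R E. binomial_half_marks M P D R \<longrightarrow>
            random_direction_stable_multi_matching M P D R E \<longrightarrow>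
            (AE \<omega> in M. at_most_one_infinite_component (P \<omega>) (E \<omega>)))"
proof (intro conjI allI impI)
  have P: "point_process M bounded_borel P"
    using assms(2) by (simp add: poisson_process_def)
  {
    fix E assume E: "stable_multi_matching M P D E"
    then have "AE \<omega> in M. \<forall>x\<in>P \<omega>. \<forall>y\<in>P \<omega>. x \<noteq> y \<longrightarrow>
        Upair x y \<in> E \<omega> \<or>
        \<not> (\<exists>z. Upair x z \<in> E \<omega> \<and> \<bar>x - z\<bar> > \<bar>x - y\<bar>) \<or>
        \<not> (\<exists>z. Upair y z \<in> E \<omega> \<and> \<bar>y - z\<bar> > \<bar>x - y\<bar>)"
      by (simp add: stable_multi_matching_def)
    then have "AE \<omega> in M. \<forall>x\<in>P \<omega>. \<forall>y\<in>P \<omega>. \<forall>u\<in>P \<omega>. \<forall>v\<in>P \<omega>.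
        Upair x y \<in> E \<omega> \<longrightarrow> Upair u v \<in> E \<omega> \<longrightarrow> x < u \<longrightarrow> u < y \<longrightarrow> y < v \<longrightarrow> Upair u y \<in> E \<omega>"
    proof eventually_elim
      case (elim \<omega>)
      show ?case
      proof (intro ballI impI)
        fix x y u v
        assume A: "x \<in> P \<omega>" "y \<in> P \<omega>" "u \<in> P \<omega>" "v \<in> P \<omega>" "Upair x y \<in> E \<omega>" "Upair u v \<in> E \<omega>"
          "x < u" "u < y" "y < v"
        have "Upair y x \<in> E \<omega>" using A by (metis Upair_inject)
        moreover have "\<bar>u - v\<bar> > \<bar>u - y\<bar>" "\<bar>y - x\<bar> > \<bar>u - y\<bar>" "u \<noteq> y" using A by auto
        ultimately show "Upair u y \<in> E \<omega>" using elim A by blast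
      qed
    qed
    then show "AE \<omega> in M. at_most_one_infinite_component (P \<omega>) (E \<omega>)"
      using matching_scheme_unique_infinite_component[OF assms(1) P, of D E] E
      by (simp add: stable_multi_matching_def)
  }
  {
    fix R E assume E: "random_direction_stable_multi_matching M P D R E"
    then have "AE \<omega> in M. \<forall>x\<in>P \<omega>. \<forall>y\<in>P \<omega>. x < y \<longrightarrow>
        Upair x y \<in> E \<omega> \<or>
        \<not> (\<exists>z>x. Upair x z \<in> E \<omega> \<and> \<bar>x - z\<bar> > \<bar>x - y\<bar>) \<or>
        \<not> (\<exists>z<y. Upair z y \<in> E \<omega> \<and> \<bar>z - y\<bar> > \<bar>x - y\<bar>)"
      by (simp add: random_direction_stable_multi_matching_def)
    then have "AE \<omega> in M. \<forall>x\<in>P \<omega>. \<forall>y\<in>P \<omega>. \<forall>u\<in>P \<omega>. \<forall>v\<in>P \<omega>.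
        Upair x y \<in> E \<omega> \<longrightarrow> Upair u v \<in> E \<omega> \<longrightarrow> x < u \<longrightarrow> u < y \<longrightarrow> y < v \<longrightarrow> Upair u y \<in> E \<omega>"
    proof eventually_elim
      case (elim \<omega>)
      show ?case
      proof (intro ballI impI)
        fix x y u v
        assume A: "x \<in> P \<omega>" "y \<in> P \<omega>" "u \<in> P \<omega>" "v \<in> P \<omega>" "Upair x y \<in> E \<omega>" "Upair u v \<in> E \<omega>"
          "x < u" "u < y" "y < v"
        have "\<bar>u - v\<bar> > \<bar>u - y\<bar>" "\<bar>x - y\<bar> > \<bar>u - y\<bar>" "u < v" "x < y" using A by auto
        then show "Upair u y \<in> E \<omega>" using elim A by blast
      qed
    qed
    then show "AE \<omega> in M. at_most_one_infinite_component (P \<omega>) (E \<omega>)"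
      using matching_scheme_unique_infinite_component[OF assms(1) P, of D E] E
      by (simp add: random_direction_stable_multi_matching_def)
  }
qed

end
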